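(* Let $n\ge 1$ and $m\ge 0$ be integers. For the closure space $(\mathbb{Z}_n,c_m)$, \[H_1(\mathbb{Z}_n,c_m)\cong\begin{cases} \mathbb{Z}, & \text{if } 3\le 3m<n,\\ 0, & \text{if } \left\lfloor\frac{n}{2}\right\rfloor \le m, \text{ or if } n=3 \text{ and } 1\le m. \end{cases}\]
   Context: A (Čech) closure space is a pair $(X,c)$ of a set $X$ and a function $c:2^X\to 2^X$ with $c(\varnothing)=\varnothing$, $A\subset c(A)$, and $c(A\cup B)=c(A)\cup c(B)$ for all $A,B\subset X$. Topological spaces are the closure spaces with $c(c(A))=c(A)$ for all $A$, where $c$ is the topological closure. A map $f:(X,c)\to(Y,d)$ is continuous if $f(c(A))\subset d(f(A))$ for all $A\subset X$. $\mathbb{Z}_n=\{0,1,\dots,n-1\}$ with metric $d(i,j)=\min\{|k| : k\equiv i-j \bmod n\}$. For $m\ge 0$, $c_m(i)=\{j\in\mathbb{Z}_n : d(i,j)\le m\}$ and $c_m(A)=\bigcup_{i\in A}c_m(i)$ for $A\subset\mathbb{Z}_n$. Singular homology: let $|\Delta^n|=\{(t_0,\dots,t_n)\in\mathbb{R}^{n+1} : \sum_i t_i=1,\ t_i\ge 0\}=[e_0,\dots,e_n]$ with the Euclidean topology. For a closure space $X$, $C_n(X)$ is the free abelian group on continuous maps $\sigma:|\Delta^n|\to X$ (and $C_n(X)=0$ for $n<0$), $\partial_n(\sigma)=\sum_{i=0}^n(-1)^i\sigma|_{[e_0,\dots,\hat e_i,\dots,e_n]}$, and $H_n(X)=\ker\partial_n/\operatorname{im}\partial_{n+1}$;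 $H_k(\mathbb{Z}_n,c_m)$ denotes $H_k$ of the closure space $(\mathbb{Z}_n,c_m)$ (not relative homology). *)

theory Defs
  imports "HOL-Homology.Homology" "HOL-Number_Theory.Cong"
begin

text \<open>A closure space is given by a carrier \<open>X\<close> and an operator \<open>c\<close>, of which only the values on
  subsets of \<open>X\<close> are relevant.\<close>

locale closure_space =
  fixes X :: "'a set" and c :: "'a set \<Rightarrow> 'a set"
  assumes closure_subset_carrier: "A \<subseteq> X \<Longrightarrow> c A \<subseteq> X"
    and closure_empty: "c {} = {}"
    and closure_increasing: "A \<subseteq> X \<Longrightarrow> A \<subseteq> c A"
    and closure_union: "\<lbrakk>A \<subseteq> X; B \<subseteq> X\<rbrakk> \<Longrightarrow> c (A \<union> B) = c A \<union> c B"

definition closure_continuous ::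
  "'a set \<Rightarrow> ('a set \<Rightarrow> 'a set) \<Rightarrow> 'b set \<Rightarrow> ('b set \<Rightarrow> 'b set) \<Rightarrow> ('a \<Rightarrow> 'b) \<Rightarrow> bool"
  where "closure_continuous X c Y d f \<longleftrightarrow>
    f \<in> X \<rightarrow> Y \<and> (\<forall>A. A \<subseteq> X \<longrightarrow> f ` c A \<subseteq> d (f ` A))"

lemma closure_space_topology: "closure_space (topspace T) ((closure_of) T)"
  by unfold_locales (simp_all add: closure_of_subset_topspace closure_of_subset closure_of_Un)

lemma closure_continuous_topology:
  "closure_continuous (topspace S) ((closure_of) S) (topspace T) ((closure_of) T) f
     \<longleftrightarrow> continuous_map S T f"
proof
  assume "closure_continuous (topspace S) ((closure_of) S) (topspace T) ((closure_of) T) f"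
  then show "continuous_map S T f"
    by (auto simp: closure_continuous_def continuous_map_eq_image_closure_subset_alt
        image_subset_iff_funcset)
next
  assume "continuous_map S T f"
  then show "closure_continuous (topspace S) ((closure_of) S) (topspace T) ((closure_of) T) f"
    by (simp add: closure_continuous_def continuous_map_funspace
        continuous_map_image_closure_subset)
qed

text \<open>The singular chain complex follows \<open>HOL-Homology\<close>. A point of the standard simplex is a sequence
  in \<open>nat \<Rightarrow> real\<close> vanishing above \<open>p\<close>, so the product topology induces the Euclidean topology on it;
  singular simplices are \<open>undefined\<close> off the standard simplex, so that equality of simplices is
  equality of maps on the simplex. The operator \<open>chain_boundary\<close> does not refer to the topology of the
  target, and is \<open>0\<close> in degree \<open>0\<close>.\<close>

abbreviation simplex_topology :: "nat \<Rightarrow> (nat \<Rightarrow> real) topology"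
  where "simplex_topology p \<equiv> subtopology (powertop_real UNIV) (standard_simplex p)"

definition closure_singular_simplices ::
  "nat \<Rightarrow> 'a set \<Rightarrow> ('a set \<Rightarrow> 'a set) \<Rightarrow> ((nat \<Rightarrow> real) \<Rightarrow> 'a) set"
  where "closure_singular_simplices p X c =
    {\<sigma> \<in> extensional (standard_simplex p).
       closure_continuous (standard_simplex p) ((closure_of) (simplex_topology p)) X c \<sigma>}"

definition closure_chain_group ::
  "nat \<Rightarrow> 'a set \<Rightarrow> ('a set \<Rightarrow> 'a set) \<Rightarrow> 'a chain monoid"
  where "closure_chain_group p X c = free_Abelian_group (closure_singular_simplices p X c)"

definition closure_cycles :: "nat \<Rightarrow> 'a set \<Rightarrow> ('a set \<Rightarrow> 'a set) \<Rightarrow> 'a chain set"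
  where "closure_cycles p X c =
    {z \<in> carrier (closure_chain_group p X c). chain_boundary p z = 0}"

definition closure_boundaries :: "nat \<Rightarrow> 'a set \<Rightarrow> ('a set \<Rightarrow> 'a set) \<Rightarrow> 'a chain set"
  where "closure_boundaries p X c =
    chain_boundary (Suc p) ` carrier (closure_chain_group (Suc p) X c)"

definition closure_homology_group ::
  "nat \<Rightarrow> 'a set \<Rightarrow> ('a set \<Rightarrow> 'a set) \<Rightarrow> 'a chain set monoid"
  where "closure_homology_group p X c =
    subgroup_generated (closure_chain_group p X c) (closure_cycles p X c)
      Mod closure_boundaries p X c"

lemma closure_homology_group_topology:
  "closure_homology_group p (topspace T) ((closure_of) T) = homology_group (int p) T"
proof -
  have simplices: "closure_singular_simplices q (topspace T) ((closure_of) T)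
      = singular_simplex_set q T" for q
    using closure_continuous_topology [of "simplex_topology q" T]
    by (simp add: closure_singular_simplices_def singular_simplex_def set_eq_iff conj_commute)
  then have chains: "closure_chain_group q (topspace T) ((closure_of) T) = chain_group q T" for q
    by (simp add: closure_chain_group_def chain_group_def)
  have cycles: "closure_cycles p (topspace T) ((closure_of) T) = singular_relcycle_set p T {}"
    by (simp add: closure_cycles_def chains singular_cycle set_eq_iff)
  have boundaries:
    "closure_boundaries p (topspace T) ((closure_of) T) = singular_relboundary_set p T {}"
    by (auto simp: closure_boundaries_def chains singular_boundary image_iff)
  show ?thesis
    by (simp add: closure_homology_group_def cycles boundaries chains
        nontrivial_relative_homology_group relcycle_group_def)
qed

definition cyc_dist :: "nat \<Rightarrow> nat \<Rightarrow> nat \<Rightarrow> nat"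
  where "cyc_dist n i j =
    (LEAST d. \<exists>k::int. [k = int i - int j] (mod int n) \<and> d = nat \<bar>k\<bar>)"

definition cyc_closure :: "nat \<Rightarrow> nat \<Rightarrow> nat set \<Rightarrow> nat set"
  where "cyc_closure n m A = (\<Union>i\<in>A. {j \<in> {..<n}. cyc_dist n i j \<le> m})"

lemma cyc_dist_self: "cyc_dist n i i = 0"
  unfolding cyc_dist_def by (rule Least_eq_0) (rule exI [of _ 0], simp)

lemma closure_space_cyc: "closure_space {..<n} (cyc_closure n m)"
proof
  show "A \<subseteq> cyc_closure n m A" if "A \<subseteq> {..<n}" for A
  proof
    fix i
    assume "i \<in> A"
    with that show "i \<in> cyc_closure n m A"
      unfolding cyc_closure_def by (intro UN_I [of i]) (auto simp: cyc_dist_self)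
  qed
qed (simp_all add: cyc_closure_def UN_Un, blast)

end

theory Submission
  imports Defs
begin

text \<open>
  Suppose first that \<open>1 \<le> m\<close> and \<open>3m < n\<close>. Then \<open>(\<int>\<^sub>n, c\<^sub>m)\<close> behaves like a circle whose universal covering is
  \<open>\<int>\<close>, with integers at distance at most \<open>m\<close> being close. A map into the cycle is continuous if, near
  each point, its values stay within \<open>m\<close> of the value at this point (\<open>closure_continuous_cyc_iff\<close>). Such a
  map has a continuous lift to \<open>\<int>\<close> locally if \<open>3m < n\<close> (\<open>local_lift\<close>), any two lifts on a connected set
  differ by a constant multiple of \<open>n\<close> (\<open>lifts_differ_by_constant\<close>), and subdivision yields lifts on rectangles,
  hence on the standard simplices of dimension \<open>1\<close> and \<open>2\<close> (\<open>rectangle_lift\<close>).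

  The increment of a lift defines the winding number of a \<open>1\<close>-simplex, and by additivity that of a
  chain. Boundaries have winding number \<open>0\<close>, because \<open>2\<close>-simplices lift
  (\<open>total_winding_boundary\<close>), and a loop of winding number \<open>1\<close> exists because \<open>1 \<le> m\<close> permits unit
  steps (\<open>unit_winding_cycle\<close>).

  It remains to see that a cycle of winding number \<open>0\<close> bounds. The integers are contractible in the
  following sense: truncating a bounded path of integers to \<open>{-r..r}\<close>, with \<open>r\<close> decreasing to \<open>0\<close> in unit
  steps, is a homotopy to the constant path \<open>0\<close>. Used as a cone this gives a \<open>2\<close>-simplex whose faces are
  the path and the rays from \<open>0\<close> to its end points, so that modulo boundaries a lifted path is the
  difference of two rays (\<open>path_homologous_to_rays\<close>). Translating rays by multiples of \<open>n\<close> turns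
  this into an expression of any chain by its boundary and its winding number
  (\<open>cyc_chain_homologous\<close>), from which the claim is evident.

  If \<open>n div 2 \<le> m\<close>, which covers \<open>n = 3\<close> and \<open>1 \<le> m\<close>, then any two points of the cycle are close. The
  closure space is the indiscrete topological space on \<open>n\<close> points, which is contractible.
\<close>

section \<open>Maps controlled near each point\<close>
text \<open>The relation is required between the value at the centre and the values nearby, not among the
  latter; this is what continuity into a closure space amounts to.\<close>
definition locally_related ::
    "('b \<Rightarrow> 'b \<Rightarrow> bool) \<Rightarrow> 'a::topological_space set \<Rightarrow> ('a \<Rightarrow> 'b) \<Rightarrow> bool"
  where "locally_related R S f \<longleftrightarrow>
    (\<forall>x\<in>S. \<exists>U. open U \<and> x \<in> U \<and> (\<forall>y\<in>U \<inter> S. R (f x) (f y)))"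

lemma locally_relatedI:
  assumes "\<And>x. x \<in> S \<Longrightarrow> \<exists>U. open U \<and> x \<in> U \<and> (\<forall>y\<in>U \<inter> S. R (f x) (f y))"
  shows "locally_related R S f"
  using assms by (simp add: locally_related_def)

lemma locally_relatedE:
  assumes "locally_related R S f" "x \<in> S"
  obtains U where "open U" "x \<in> U" "\<And>y. y \<in> U \<Longrightarrow> y \<in> S \<Longrightarrow> R (f x) (f y)"
proof -
  obtain U where "open U \<and> x \<in> U \<and> (\<forall>y\<in>U \<inter> S. R (f x) (f y))"
    using bspec [OF assms(1) [unfolded locally_related_def] assms(2)] by (rule exE)
  then show thesis
    by (intro that [of U]) auto
qed

text \<open>Faces, restrictions and reparametrisations of simplices are all instances.\<close>
lemma locally_related_compose:
  assumes f: "locally_related R T f" and g: "continuous_on S g" "g ` S \<subseteq> T"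
  shows "locally_related R S (\<lambda>x. f (g x))"
proof (rule locally_relatedI)
  fix x assume "x \<in> S"
  with g(2) have "g x \<in> T" by blast
  then obtain U where U: "open U" "g x \<in> U" "\<And>y. y \<in> U \<Longrightarrow> y \<in> T \<Longrightarrow> R (f (g x)) (f y)"
    by (rule locally_relatedE [OF f]) blast
  obtain V where "open V" "V \<inter> S = g -` U \<inter> S"
    using g(1) U(1) unfolding continuous_on_open_invariant by blast
  with U \<open>x \<in> S\<close> g(2) show "\<exists>U. open U \<and> x \<in> U \<and> (\<forall>y\<in>U \<inter> S. R (f (g x)) (f (g y)))"
    by (intro exI [of _ V]) blast
qed

lemma locally_related_subset:
  assumes "locally_related R T f" "S \<subseteq> T"
  shows "locally_related R S f"
  using locally_related_compose [OF assms(1), of S "\<lambda>x. x"] assms(2) by auto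

lemma locally_related_map:
  assumes "locally_related R S f" "\<And>x y. x \<in> S \<Longrightarrow> y \<in> S \<Longrightarrow> R (f x) (f y) \<Longrightarrow> Q (g x) (g y)"
  shows "locally_related Q S g"
proof (rule locally_relatedI)
  fix x assume "x \<in> S"
  then obtain U where "open U" "x \<in> U" "\<And>y. y \<in> U \<Longrightarrow> y \<in> S \<Longrightarrow> R (f x) (f y)"
    using locally_relatedE [OF assms(1)] by blast
  with \<open>x \<in> S\<close> assms(2) show "\<exists>U. open U \<and> x \<in> U \<and> (\<forall>y\<in>U \<inter> S. Q (g x) (g y))"
    by (intro exI [of _ U]) auto
qed

section \<open>Lifting to the integers\<close>
text \<open>The relation \<open>near m\<close> makes the integers into a closure space which is to \<open>(\<int>\<^sub>n, c\<^sub>m)\<close> what the line is to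
  the circle; \<open>cyc_near n m\<close> is its image modulo \<open>n\<close>.\<close>
definition near :: "nat \<Rightarrow> int \<Rightarrow> int \<Rightarrow> bool"
  where "near m a b \<longleftrightarrow> \<bar>b - a\<bar> \<le> int m"

definition cyc_near :: "nat \<Rightarrow> nat \<Rightarrow> int \<Rightarrow> int \<Rightarrow> bool"
  where "cyc_near n m a b \<longleftrightarrow> (\<exists>k. \<bar>k\<bar> \<le> int m \<and> [k = b - a] (mod int n))"

text \<open>Points of the cycle are represented by arbitrary integers, so that a lift is an integer-valued map
  agreeing with the given one modulo \<open>n\<close>.\<close>
definition is_lift ::
    "nat \<Rightarrow> nat \<Rightarrow> 'a::topological_space set \<Rightarrow> ('a \<Rightarrow> int) \<Rightarrow> ('a \<Rightarrow> int) \<Rightarrow> bool"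
  where "is_lift n m S f L \<longleftrightarrow>
    locally_related (near m) S L \<and> (\<forall>x\<in>S. [L x = f x] (mod int n))"

lemma is_lift_compose:
  assumes "is_lift n m T f L" "continuous_on S g" "g ` S \<subseteq> T"
  shows "is_lift n m S (\<lambda>x. f (g x)) (\<lambda>x. L (g x))"
  using assms locally_related_compose [of "near m" T L S g]
  by (auto simp: is_lift_def image_subset_iff)

lemma is_lift_subset:
  assumes "is_lift n m T f L" "S \<subseteq> T"
  shows "is_lift n m S f L"
  using assms locally_related_subset unfolding is_lift_def by blast

lemma is_lift_shift:
  assumes "is_lift n m S f L"
  shows "is_lift n m S f (\<lambda>x. L x + int n * k)"
  using assms unfolding is_lift_def
  by (auto intro: locally_related_map [where f = L] simp: near_def cong_def)

lemma cong_imp_eq_if_close: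
  assumes "[a = b] (mod int n)" "\<bar>a - b\<bar> < int n"
  shows "a = b"
  using assms dvd_imp_le_int [of "a - b" "int n"] by (auto simp: cong_iff_dvd_diff)

text \<open>Near a point each of two lifts moves by at most \<open>m\<close>, so that their difference, a multiple of \<open>n\<close>,
  changes by at most \<open>2m < n\<close>. It is therefore locally constant.\<close>
lemma lifts_differ_by_constant:
  assumes m: "2 * m < n" and S: "connected S"
    and L: "is_lift n m S f L" and L': "is_lift n m S f L'"
  obtains k where "\<And>x. x \<in> S \<Longrightarrow> L x = L' x + int n * k"
proof -
  have LL: "locally_related (near m) S L" "locally_related (near m) S L'"
    using L L' by (simp_all add: is_lift_def)
  have "(\<lambda>x. L x - L' x) constant_on S"
  proof (rule locally_constant_imp_constant [OF S])
    show "\<exists>T. openin (top_of_set S) T \<and> x \<in> T \<and> (\<forall>y\<in>T. L y - L' y = L x - L' x)"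
      if x: "x \<in> S" for x
    proof -
      obtain U where U: "open U" "x \<in> U" "\<And>y. y \<in> U \<Longrightarrow> y \<in> S \<Longrightarrow> near m (L x) (L y)"
        by (rule locally_relatedE [OF LL(1) x]) blast
      obtain V where V: "open V" "x \<in> V" "\<And>y. y \<in> V \<Longrightarrow> y \<in> S \<Longrightarrow> near m (L' x) (L' y)"
        by (rule locally_relatedE [OF LL(2) x]) blast
      have "L y - L' y = L x - L' x" if y: "y \<in> U \<inter> V" "y \<in> S" for y
      proof (rule cong_imp_eq_if_close)
        have "[L z - L' z = f z - f z] (mod int n)" if "z \<in> S" for z
          using L L' that unfolding is_lift_def by (intro cong_diff) auto
        from this [OF x] this [OF y(2)] show "[L y - L' y = L x - L' x] (mod int n)"
          by (simp add: cong_def)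
        show "\<bar>L y - L' y - (L x - L' x)\<bar> < int n"
          using U(3) [of y] V(3) [of y] y m unfolding near_def by simp
      qed
      moreover have "openin (top_of_set S) (S \<inter> (U \<inter> V))"
        using U(1) V(1) by (simp add: openin_open_Int open_Int)
      moreover have "x \<in> S \<inter> (U \<inter> V)"
        using U(2) V(2) x by simp
      ultimately show ?thesis by blast
    qed
  qed
  then obtain c where c: "\<And>x. x \<in> S \<Longrightarrow> L x - L' x = c"
    by (auto simp: constant_on_def)
  have "\<exists>k. c = int n * k" if "x \<in> S" for x
  proof -
    have "[L x = L' x] (mod int n)"
      using L L' that unfolding is_lift_def by (simp add: cong_def)
    with c [OF that] show ?thesis by (auto simp: cong_iff_dvd_diff)
  qed
  then obtain k where "c = int n * k \<or> S = {}"
    by blast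
  with c show thesis
    by (intro that [of k]) (auto simp: algebra_simps)
qed

text \<open>Close to \<open>x\<close> all values lie within \<open>m\<close> of \<open>f x\<close>, which singles out an integer for each of them.
  The bound \<open>3m < n\<close> is what makes this choice continuous at the neighbours \<open>y\<close> of \<open>x\<close> as well: the
  chosen integers for \<open>y\<close> and a nearby \<open>z\<close> differ by at most \<open>2m\<close>, and the difference is congruent to
  an integer of absolute value at most \<open>m\<close>, hence equal to it.\<close>
lemma local_lift:
  assumes m: "3 * m < n" and f: "locally_related (cyc_near n m) S f" and x: "x \<in> S"
  obtains U L where "open U" "x \<in> U" "is_lift n m (U \<inter> S) f L"
proof -
  obtain U where U: "open U" "x \<in> U" "\<And>y. y \<in> U \<Longrightarrow> y \<in> S \<Longrightarrow> cyc_near n m (f x) (f y)"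
    by (rule locally_relatedE [OF f x]) blast
  have "\<forall>y\<in>U \<inter> S. \<exists>k. \<bar>k\<bar> \<le> int m \<and> [k = f y - f x] (mod int n)"
    using U(3) by (simp add: cyc_near_def)
  from bchoice [OF this] obtain k where
    k: "\<And>y. y \<in> U \<inter> S \<Longrightarrow> \<bar>k y\<bar> \<le> int m \<and> [k y = f y - f x] (mod int n)"
    by blast
  have "locally_related (near m) (U \<inter> S) (\<lambda>y. f x + k y)"
  proof (rule locally_related_map)
    show "locally_related (cyc_near n m) (U \<inter> S) f"
      using f by (rule locally_related_subset) simp
    show "near m (f x + k y) (f x + k z)"
      if yz: "y \<in> U \<inter> S" "z \<in> U \<inter> S" "cyc_near n m (f y) (f z)" for y z
    proof -
      obtain j where j: "\<bar>j\<bar> \<le> int m" "[j = f z - f y] (mod int n)"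
        using yz(3) unfolding cyc_near_def by blast
      have "[k z - k y = (f z - f x) - (f y - f x)] (mod int n)"
        using k yz by (intro cong_diff) auto
      with j(2) have "[k z - k y = j] (mod int n)"
        by (simp add: cong_def)
      then have "k z - k y = j"
        by (rule cong_imp_eq_if_close) (use k [OF yz(1)] k [OF yz(2)] j(1) m in linarith)
      with j(1) show ?thesis by (simp add: near_def)
    qed
  qed
  moreover have "[f x + k y = f y] (mod int n)" if "y \<in> U \<inter> S" for y
    using k [OF that] cong_add_lcancel [of "f x" "k y" "f y - f x" "int n"] by simp
  ultimately have "is_lift n m (U \<inter> S) f (\<lambda>y. f x + k y)"
    unfolding is_lift_def by blast
  with U(1,2) show thesis by (rule that)
qed

text \<open>On the connected intersection the two lifts differ by a constant multiple of \<open>n\<close>, and after a shift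
  they agree there. Closedness ensures that a point outside one of the two sets has a neighbourhood
  that misses this set.\<close>
lemma glue_lifts:
  assumes m: "2 * m < n" and AB: "closed A" "closed B" "connected (A \<inter> B)" "A \<inter> B \<noteq> {}"
    and A: "is_lift n m A f L" and B: "is_lift n m B f M"
  shows "\<exists>L. is_lift n m (A \<union> B) f L"
proof -
  obtain k where k: "\<And>x. x \<in> A \<inter> B \<Longrightarrow> L x = M x + int n * k"
    using lifts_differ_by_constant [OF m AB(3), of f L M] is_lift_subset [OF A] is_lift_subset [OF B]
    by (meson inf_le1 inf_le2)
  define M' where "M' \<equiv> \<lambda>x. M x + int n * k"
  have B': "is_lift n m B f M'"
    unfolding M'_def using B by (rule is_lift_shift)
  define N where "N \<equiv> \<lambda>x. if x \<in> A then L x else M' x"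
  have NA: "N x = L x" if "x \<in> A" for x
    using that by (simp add: N_def)
  have NB: "N x = M' x" if "x \<in> B" for x
    using that k by (simp add: N_def M'_def)
  have nA: "\<exists>U. open U \<and> x \<in> U \<and> (\<forall>y\<in>U \<inter> A. near m (N x) (N y))" if x: "x \<in> A \<union> B" for x
  proof (cases "x \<in> A")
    case True
    with A show ?thesis unfolding is_lift_def locally_related_def by (simp add: NA)
  next
    case False
    then show ?thesis by (intro exI [of _ "- A"]) (auto simp: AB open_Compl)
  qed
  have nB: "\<exists>U. open U \<and> x \<in> U \<and> (\<forall>y\<in>U \<inter> B. near m (N x) (N y))" if x: "x \<in> A \<union> B" for x
  proof (cases "x \<in> B")
    case True
    with B' show ?thesis unfolding is_lift_def locally_related_def by (simp add: NB)
  next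
    case False
    then show ?thesis by (intro exI [of _ "- B"]) (auto simp: AB open_Compl)
  qed
  have "locally_related (near m) (A \<union> B) N"
  proof (rule locally_relatedI)
    fix x assume "x \<in> A \<union> B"
    with nA nB obtain U V where "open U" "x \<in> U" "\<forall>y\<in>U \<inter> A. near m (N x) (N y)"
      and "open V" "x \<in> V" "\<forall>y\<in>V \<inter> B. near m (N x) (N y)"
      by meson
    then show "\<exists>U. open U \<and> x \<in> U \<and> (\<forall>y\<in>U \<inter> (A \<union> B). near m (N x) (N y))"
      by (intro exI [of _ "U \<inter> V"]) auto
  qed
  moreover have "\<forall>x\<in>A \<union> B. [N x = f x] (mod int n)"
    using A B' NA NB unfolding is_lift_def by auto
  ultimately show ?thesis unfolding is_lift_def by blast
qed

text \<open>Subdividing a rectangle into small ones and gluing is organised as two nested bisection arguments,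
  one for each coordinate: first a thin vertical strip around a given abscissa is lifted, then the
  strips are put side by side. The pieces meet in segments, which are connected.\<close>
lemma rectangle_lift:
  fixes f :: "real \<times> real \<Rightarrow> int"
  assumes m: "3 * m < n" and le: "a \<le> b" "c \<le> d"
    and f: "locally_related (cyc_near n m) ({a..b} \<times> {c..d}) f"
  shows "\<exists>L. is_lift n m ({a..b} \<times> {c..d}) f L"
proof -
  define liftable where "liftable S \<longleftrightarrow> (\<exists>L. is_lift n m S f L)" for S :: "(real \<times> real) set"
  have m2: "2 * m < n" using m by simp
  \<comment> \<open>Names for the full sides: the bisection below generalises the end points of the moving
    intervals and must leave these alone.\<close>
  define X Y where "X = {a..b}" and "Y = {c..d}"
  have glue: "liftable (A \<union> B)"
    if "liftable A" "liftable B" "closed A" "closed B" "connected (A \<inter> B)" "A \<inter> B \<noteq> {}" for A B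
    using that glue_lifts [OF m2] unfolding liftable_def by metis
  have sub: "liftable A" if "liftable B" "A \<subseteq> B" for A B
    using that is_lift_subset unfolding liftable_def by metis
  have square: "\<exists>e>0. \<forall>p q r s. p \<le> x \<and> x \<le> q \<and> q - p < e \<and> r \<le> y \<and> y \<le> s \<and> s - r < e \<longrightarrow>
      liftable (({p..q} \<inter> X) \<times> ({r..s} \<inter> Y))" if xy: "a \<le> x" "x \<le> b" "c \<le> y" "y \<le> d" for x y
  proof -
    from xy obtain U L where U: "open U" "(x,y) \<in> U" and L: "is_lift n m (U \<inter> X \<times> Y) f L"
      using local_lift [OF m f, of "(x,y)"] by (auto simp: X_def Y_def)
    obtain S T where ST: "open S" "open T" "(x,y) \<in> S \<times> T" "S \<times> T \<subseteq> U"
      using U by (rule open_prod_elim)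
    then obtain e1 e2 where e: "e1 > 0" "ball x e1 \<subseteq> S" "e2 > 0" "ball y e2 \<subseteq> T"
      by (meson mem_Sigma_iff open_contains_ball)
    have "liftable (({p..q} \<inter> X) \<times> ({r..s} \<inter> Y))"
      if "p \<le> x \<and> x \<le> q \<and> q - p < min e1 e2 \<and> r \<le> y \<and> y \<le> s \<and> s - r < min e1 e2" for p q r s
    proof (rule sub)
      show "liftable (U \<inter> X \<times> Y)" using L unfolding liftable_def by blast
      have "{p..q} \<subseteq> ball x e1" "{r..s} \<subseteq> ball y e2"
        using that by (auto simp: dist_real_def)
      with e ST show "({p..q} \<inter> X) \<times> ({r..s} \<inter> Y) \<subseteq> U \<inter> X \<times> Y" by blast
    qed
    with e show ?thesis by (intro exI [of _ "min e1 e2"]) auto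
  qed
  have strip: "\<exists>e>0. \<forall>p q. p \<le> x \<and> x \<le> q \<and> q - p < e \<longrightarrow>
      liftable (({p..q} \<inter> X) \<times> ({c..d} \<inter> Y))"
    if x: "a \<le> x" "x \<le> b" for x
    using le(2)
  proof (induction rule: Bolzano)
    case (trans r s t)
    then obtain e1 e2 where e: "e1 > 0" "e2 > 0"
      and 1: "\<And>p q. p \<le> x \<and> x \<le> q \<and> q - p < e1 \<Longrightarrow> liftable (({p..q} \<inter> X) \<times> ({r..s} \<inter> Y))"
      and 2: "\<And>p q. p \<le> x \<and> x \<le> q \<and> q - p < e2 \<Longrightarrow> liftable (({p..q} \<inter> X) \<times> ({s..t} \<inter> Y))"
      by metis
    have "liftable (({p..q} \<inter> X) \<times> ({r..t} \<inter> Y))"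
      if pq: "p \<le> x \<and> x \<le> q \<and> q - p < min e1 e2" for p q
    proof (cases "s \<in> Y")
      case True
      have "liftable (({p..q} \<inter> X) \<times> ({r..s} \<inter> Y) \<union> ({p..q} \<inter> X) \<times> ({s..t} \<inter> Y))"
      proof (rule glue)
        have "({p..q} \<inter> X) \<times> ({r..s} \<inter> Y) \<inter> ({p..q} \<inter> X) \<times> ({s..t} \<inter> Y)
            = {max p a..min q b} \<times> {s..s}"
          using True trans by (auto simp: X_def)
        then show "connected (({p..q} \<inter> X) \<times> ({r..s} \<inter> Y) \<inter> ({p..q} \<inter> X) \<times> ({s..t} \<inter> Y))"
          "({p..q} \<inter> X) \<times> ({r..s} \<inter> Y) \<inter> ({p..q} \<inter> X) \<times> ({s..t} \<inter> Y) \<noteq> {}"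
          using pq x by (auto intro!: connected_Times)
      qed (use 1 2 pq in \<open>auto intro!: closed_Times closed_Int simp: X_def Y_def\<close>)
      moreover have "{r..t} \<inter> Y = ({r..s} \<inter> Y) \<union> ({s..t} \<inter> Y)"
        using trans by auto
      ultimately show ?thesis by (simp add: Sigma_Un_distrib2 Times_Un_distrib1 [symmetric])
    next
      case False
      then consider "s < c" | "d < s" by (force simp: Y_def)
      then have "{r..t} \<inter> Y = {r..s} \<inter> Y \<or> {r..t} \<inter> Y = {s..t} \<inter> Y"
        using trans(3,4) by cases (auto simp: Y_def)
      with 1 2 pq show ?thesis by auto
    qed
    with e show ?case by (intro exI [of _ "min e1 e2"]) auto
  next
    case (local y)
    then obtain e where "e > 0" "\<And>p q r s. p \<le> x \<and> x \<le> q \<and> q - p < e \<and> r \<le> y \<and> y \<le> s \<and> s - r < e \<Longrightarrow>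
      liftable (({p..q} \<inter> X) \<times> ({r..s} \<inter> Y))"
      using square x by meson
    then show ?case by (intro exI [of _ e]) auto
  qed
  have "liftable (({a..b} \<inter> X) \<times> Y)"
    using le(1)
  proof (induction rule: Bolzano)
    case (trans p q r)
    show ?case
    proof (cases "q \<in> X")
      case True
      have "liftable (({p..q} \<inter> X) \<times> Y \<union> ({q..r} \<inter> X) \<times> Y)"
      proof (rule glue)
        have "({p..q} \<inter> X) \<times> Y \<inter> ({q..r} \<inter> X) \<times> Y = {q..q} \<times> Y"
          using True trans by auto
        then show "connected (({p..q} \<inter> X) \<times> Y \<inter> ({q..r} \<inter> X) \<times> Y)"
            "({p..q} \<inter> X) \<times> Y \<inter> ({q..r} \<inter> X) \<times> Y \<noteq> {}"
          using le by (auto intro!: connected_Times simp: Y_def)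
      qed (use trans in \<open>auto intro!: closed_Times closed_Int simp: X_def Y_def\<close>)
      moreover have "{p..r} \<inter> X = ({p..q} \<inter> X) \<union> ({q..r} \<inter> X)"
        using trans by auto
      ultimately show ?thesis by (simp add: Sigma_Un_distrib1)
    next
      case False
      then consider "q < a" | "b < q" by (force simp: X_def)
      then have "{p..r} \<inter> X = {p..q} \<inter> X \<or> {p..r} \<inter> X = {q..r} \<inter> X"
        using trans(3,4) by cases (auto simp: X_def)
      with trans show ?thesis by auto
    qed
  next
    case (local x)
    with strip [of x] show ?case by (simp add: Y_def)
  qed
  then show ?thesis by (simp add: liftable_def X_def Y_def)
qed

section \<open>Singular simplices of the cyclic closure space\<close>
abbreviation cyc_simplices :: "nat \<Rightarrow> nat \<Rightarrow> nat \<Rightarrow> ((nat \<Rightarrow> real) \<Rightarrow> nat) set"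
  where "cyc_simplices n m p \<equiv> closure_singular_simplices p {..<n} (cyc_closure n m)"

lemma cyc_dist_le_iff: "cyc_dist n i j \<le> m \<longleftrightarrow> cyc_near n m (int j) (int i)"
proof
  have "\<exists>d. \<exists>k::int. [k = int i - int j] (mod int n) \<and> d = nat \<bar>k\<bar>"
    by (metis cong_refl)
  from LeastI_ex [OF this]
  have "\<exists>k::int. [k = int i - int j] (mod int n) \<and> cyc_dist n i j = nat \<bar>k\<bar>"
    by (simp add: cyc_dist_def)
  moreover assume "cyc_dist n i j \<le> m"
  ultimately obtain k :: int where "[k = int i - int j] (mod int n)" "nat \<bar>k\<bar> \<le> m"
    by auto
  then show "cyc_near n m (int j) (int i)"
    unfolding cyc_near_def by (intro exI [of _ k]) auto
next
  assume "cyc_near n m (int j) (int i)"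
  then obtain k where k: "\<bar>k\<bar> \<le> int m" "[k = int i - int j] (mod int n)"
    by (auto simp: cyc_near_def)
  have "cyc_dist n i j \<le> nat \<bar>k\<bar>"
    unfolding cyc_dist_def using k(2) by (intro Least_le) auto
  with k(1) show "cyc_dist n i j \<le> m" by simp
qed

text \<open>Continuity of \<open>f\<close> at \<open>x\<close> says that \<open>x\<close> is not in the closure of the set of points whose value is
  far from \<open>f x\<close>, in other words that the value stays close to \<open>f x\<close> on a neighbourhood of \<open>x\<close>. The
  closeness is always to the value at the centre: two points of the neighbourhood may have values
  \<open>2m\<close> apart.\<close>
lemma closure_continuous_cyc_iff:
  fixes S :: "'a::topological_space set"
  shows "closure_continuous S ((closure_of) (top_of_set S)) {..<n} (cyc_closure n m) f \<longleftrightarrow>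
    f \<in> S \<rightarrow> {..<n} \<and> locally_related (cyc_near n m) S (\<lambda>x. int (f x))"
    (is "?C \<longleftrightarrow> ?F \<and> ?L")
proof (intro iffI conjI)
  assume C: ?C
  then show F: ?F by (simp add: closure_continuous_def)
  show ?L
  proof (rule locally_relatedI)
    fix x assume x: "x \<in> S"
    define A where "A = {y\<in>S. \<not> cyc_near n m (int (f x)) (int (f y))}"
    have "x \<notin> top_of_set S closure_of A"
    proof
      assume "x \<in> top_of_set S closure_of A"
      moreover have "A \<subseteq> S" by (auto simp: A_def)
      ultimately have "f x \<in> cyc_closure n m (f ` A)"
        using C unfolding closure_continuous_def by blast
      then show False
        by (auto simp: cyc_closure_def cyc_dist_le_iff A_def)
    qed
    then obtain T where T: "openin (top_of_set S) T" "x \<in> T" "\<And>y. y \<in> T \<Longrightarrow> y \<notin> A"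
      using x by (auto simp: in_closure_of)
    then obtain U where "open U" "T = S \<inter> U"
      by (auto simp: openin_open)
    with T(2,3) show "\<exists>U. open U \<and> x \<in> U \<and> (\<forall>y\<in>U \<inter> S. cyc_near n m (int (f x)) (int (f y)))"
      by (intro exI [of _ U]) (auto simp: A_def)
  qed
next
  assume "?F \<and> ?L"
  then have F: ?F and L: ?L by auto
  have "f x \<in> cyc_closure n m (f ` A)" if A: "A \<subseteq> S" and x: "x \<in> top_of_set S closure_of A" for A x
  proof -
    have "x \<in> S" using x by (simp add: in_closure_of)
    obtain U where U: "open U" "x \<in> U"
      "\<And>y. y \<in> U \<Longrightarrow> y \<in> S \<Longrightarrow> cyc_near n m (int (f x)) (int (f y))"
      by (rule locally_relatedE [OF L \<open>x \<in> S\<close>]) blast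
    have "openin (top_of_set S) (S \<inter> U)" "x \<in> S \<inter> U"
      using U \<open>x \<in> S\<close> by (auto simp: openin_open_Int)
    with x obtain y where "y \<in> A" "y \<in> S \<inter> U"
      unfolding in_closure_of by blast
    with U(3) [of y] F \<open>x \<in> S\<close> show ?thesis
      by (auto simp: cyc_closure_def cyc_dist_le_iff)
  qed
  with F show ?C by (auto simp: closure_continuous_def)
qed

lemma cyc_simplices_iff:
  "\<sigma> \<in> cyc_simplices n m p \<longleftrightarrow> \<sigma> \<in> extensional (standard_simplex p) \<and>
     \<sigma> \<in> standard_simplex p \<rightarrow> {..<n} \<and>
     locally_related (cyc_near n m) (standard_simplex p) (\<lambda>x. int (\<sigma> x))"
  by (simp add: closure_singular_simplices_def closure_continuous_cyc_iff euclidean_product_topology)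

lemma cyc_simplex_lt: "\<sigma> \<in> cyc_simplices n m p \<Longrightarrow> x \<in> standard_simplex p \<Longrightarrow> \<sigma> x < n"
  by (auto simp: cyc_simplices_iff)

definition vertex :: "nat \<Rightarrow> nat \<Rightarrow> real"
  where "vertex i = (\<lambda>j. if j = i then 1 else 0)"

lemma vertex_in_simplex [simp]: "vertex i \<in> standard_simplex p \<longleftrightarrow> i \<le> p"
  by (simp add: vertex_def)

lemma simplical_face_vertex:
  "simplical_face k (vertex i) = vertex (if i < k then i else Suc i)"
  by (auto simp: simplical_face_def vertex_def fun_eq_iff)

lemma continuous_on_simplical_face: "continuous_on S (simplical_face k :: _ \<Rightarrow> nat \<Rightarrow> real)"
proof (rule continuous_on_coordinatewise_then_product)
  show "continuous_on S (\<lambda>x. simplical_face k x i :: real)" for i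
    by (cases "i < k"; cases "i = k")
      (auto simp: simplical_face_def intro: continuous_on_subset [OF continuous_on_product_coordinates])
qed

lemma singular_face_cyc_simplex:
  assumes "\<sigma> \<in> cyc_simplices n m p" "1 \<le> p" "k \<le> p"
  shows "singular_face p k \<sigma> \<in> cyc_simplices n m (p - Suc 0)"
proof -
  have sub: "simplical_face k ` standard_simplex (p - Suc 0) \<subseteq> standard_simplex p"
    using simplical_face_in_standard_simplex assms(2,3) by blast
  have "locally_related (cyc_near n m) (standard_simplex (p - Suc 0)) (\<lambda>x. int (\<sigma> (simplical_face k x)))"
  proof (rule locally_related_compose [OF _ continuous_on_simplical_face sub])
    show "locally_related (cyc_near n m) (standard_simplex p) (\<lambda>x. int (\<sigma> x))"
      using assms(1) by (simp add: cyc_simplices_iff)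
  qed
  then have "locally_related (cyc_near n m) (standard_simplex (p - Suc 0)) (\<lambda>x. int (singular_face p k \<sigma> x))"
    by (rule locally_related_map) (simp add: singular_face_def)
  then show ?thesis
    using assms(1) sub by (auto simp: cyc_simplices_iff singular_face_def Pi_def)
qed

text \<open>A retract of the square inherits the existence of lifts: lift the composite with the retraction,
  then restrict along the section \<open>s\<close>.\<close>
lemma lift_on_square_retract:
  fixes g :: "real \<times> real \<Rightarrow> 'a::topological_space"
  assumes m: "3 * m < n" and f: "locally_related (cyc_near n m) T f"
    and g: "continuous_on ({0..1} \<times> {0..1}) g" "g ` ({0..1} \<times> {0..1}) \<subseteq> T"
    and s: "continuous_on T s" "s ` T \<subseteq> {0..1} \<times> {0..1}" and gs: "\<And>x. x \<in> T \<Longrightarrow> g (s x) = x"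
  obtains L where "is_lift n m T f L"
proof -
  obtain L where "is_lift n m ({0..1} \<times> {0..1}) (\<lambda>x. f (g x)) L"
    using rectangle_lift [OF m _ _ locally_related_compose [OF f g]] by auto
  from is_lift_compose [OF this s] have "is_lift n m T f (\<lambda>x. L (s x))"
    using gs by (simp add: is_lift_def)
  with that show thesis .
qed

lemma sum_le_2: "(\<Sum>i\<le>2::nat. f i) = f 0 + f 1 + (f 2 :: real)"
  by (simp add: numeral_2_eq_2)

lemma simplex_1_iff:
  "x \<in> standard_simplex (Suc 0) \<longleftrightarrow>
     0 \<le> x 0 \<and> 0 \<le> x (Suc 0) \<and> x 0 + x (Suc 0) = 1 \<and> (\<forall>i>Suc 0. x i = 0)"
proof
  assume R: "0 \<le> x 0 \<and> 0 \<le> x (Suc 0) \<and> x 0 + x (Suc 0) = 1 \<and> (\<forall>i>Suc 0. x i = 0)"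
  have "0 \<le> x i \<and> x i \<le> 1" for i
    using R by (cases "i = 0"; cases "i = Suc 0") auto
  with R show "x \<in> standard_simplex (Suc 0)" by (auto simp: standard_simplex_def)
qed (auto simp: standard_simplex_def)

lemma simplex_2_iff:
  "x \<in> standard_simplex 2 \<longleftrightarrow>
     0 \<le> x 0 \<and> 0 \<le> x (Suc 0) \<and> 0 \<le> x 2 \<and> x 0 + x (Suc 0) + x 2 = 1 \<and> (\<forall>i>2. x i = 0)"
proof
  assume R: "0 \<le> x 0 \<and> 0 \<le> x (Suc 0) \<and> 0 \<le> x 2 \<and> x 0 + x (Suc 0) + x 2 = 1 \<and> (\<forall>i>2. x i = 0)"
  have "0 \<le> x i \<and> x i \<le> 1" for i
    using R by (cases "i = 0"; cases "i = Suc 0"; cases "i = 2") auto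
  with R show "x \<in> standard_simplex 2" by (auto simp: standard_simplex_def sum_le_2)
qed (auto simp: standard_simplex_def sum_le_2)

lemma simplex_1_lift:
  assumes m: "3 * m < n" and \<sigma>: "\<sigma> \<in> cyc_simplices n m 1"
  obtains L where "is_lift n m (standard_simplex 1) (\<lambda>x. int (\<sigma> x)) L"
proof (rule lift_on_square_retract [OF m])
  let ?g = "\<lambda>(u, v) i. if i = 0 then 1 - u else if i = Suc 0 then u else (0::real)"
  show "locally_related (cyc_near n m) (standard_simplex 1) (\<lambda>x. int (\<sigma> x))"
    using \<sigma> by (simp add: cyc_simplices_iff)
  show "continuous_on ({0..1} \<times> {0..1::real}) ?g"
  proof (rule continuous_on_coordinatewise_then_product)
    show "continuous_on ({0..1} \<times> {0..1::real}) (\<lambda>x. ?g x i)" for i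
      by (cases "i = 0"; cases "i = Suc 0") (auto simp: split_def intro!: continuous_intros)
  qed
  show "?g ` ({0..1} \<times> {0..1::real}) \<subseteq> standard_simplex 1"
    by (auto simp: simplex_1_iff)
  show "continuous_on (standard_simplex 1) (\<lambda>x. (x 1, 0::real))"
    by (intro continuous_intros continuous_on_subset [OF continuous_on_product_coordinates] subset_UNIV)
  show "(\<lambda>x. (x 1, 0::real)) ` standard_simplex 1 \<subseteq> {0..1} \<times> {0..1}"
    by (auto simp: simplex_1_iff)
  show "?g (x 1, 0::real) = x" if "x \<in> standard_simplex 1" for x
    using that by (auto simp: simplex_1_iff fun_eq_iff)
qed

text \<open>The square is retracted onto the triangle \<open>u + v \<le> 1\<close> by lowering \<open>v\<close> to \<open>1 - u\<close>.\<close>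
lemma simplex_2_lift:
  assumes m: "3 * m < n" and \<sigma>: "\<sigma> \<in> cyc_simplices n m 2"
  obtains L where "is_lift n m (standard_simplex 2) (\<lambda>x. int (\<sigma> x)) L"
proof (rule lift_on_square_retract [OF m])
  let ?g = "\<lambda>(u, v) i. if i = 0 then 1 - u - min v (1 - u) else if i = Suc 0 then u
              else if i = 2 then min v (1 - u) else (0::real)"
  show "locally_related (cyc_near n m) (standard_simplex 2) (\<lambda>x. int (\<sigma> x))"
    using \<sigma> by (simp add: cyc_simplices_iff)
  show "continuous_on ({0..1} \<times> {0..1}) ?g"
  proof (rule continuous_on_coordinatewise_then_product)
    show "continuous_on ({0..1} \<times> {0..1}) (\<lambda>x. ?g x i)" for i
      by (cases "i = 0"; cases "i = Suc 0"; cases "i = 2") (auto simp: split_def intro!: continuous_intros)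
  qed
  show "?g ` ({0..1} \<times> {0..1}) \<subseteq> standard_simplex 2"
    by (auto simp: simplex_2_iff)
  show "continuous_on (standard_simplex 2) (\<lambda>x. (x 1, x 2))"
    by (intro continuous_intros continuous_on_subset [OF continuous_on_product_coordinates] subset_UNIV)
  show "(\<lambda>x. (x 1, x 2)) ` standard_simplex 2 \<subseteq> {0..1} \<times> {0..1}"
    by (auto simp: simplex_2_iff)
  show "?g (x 1, x 2) = x" if "x \<in> standard_simplex 2" for x
    using that by (auto simp: simplex_2_iff fun_eq_iff)
qed

section \<open>Winding numbers\<close>
text \<open>The increment of a lift along a path exceeds the difference of the end values, taken in
  \<open>{0..<n}\<close>, by a multiple of \<open>n\<close>. The factor is an integer for every path, closed or not, and for a
  cycle the end values cancel, so that it adds up to the winding number.\<close>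
definition winding :: "nat \<Rightarrow> nat \<Rightarrow> ((nat \<Rightarrow> real) \<Rightarrow> nat) \<Rightarrow> int"
  where "winding n m \<sigma> = (THE k. \<exists>L. is_lift n m (standard_simplex 1) (\<lambda>x. int (\<sigma> x)) L \<and>
    L (vertex 1) - L (vertex 0) = int (\<sigma> (vertex 1)) - int (\<sigma> (vertex 0)) + int n * k)"

lemma connected_standard_simplex: "connected (standard_simplex p)"
  using connectedin_standard_simplex [of p] by (simp add: euclidean_product_topology)

text \<open>Any lift computes the winding number, since two lifts differ by a constant.\<close>
lemma lift_increment:
  assumes m: "2 * m < n" and L: "is_lift n m (standard_simplex 1) (\<lambda>x. int (\<sigma> x)) L"
  shows "L (vertex 1) - L (vertex 0) =
    int (\<sigma> (vertex 1)) - int (\<sigma> (vertex 0)) + int n * winding n m \<sigma>"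
proof -
  have "[L (vertex i) = int (\<sigma> (vertex i))] (mod int n)" if "i \<le> 1" for i
    using L that by (simp add: is_lift_def)
  from this [of 1] this [of 0]
  have "[L (vertex 1) - L (vertex 0) = int (\<sigma> (vertex 1)) - int (\<sigma> (vertex 0))] (mod int n)"
    by (intro cong_diff) auto
  then have "int n dvd L (vertex 1) - L (vertex 0) - (int (\<sigma> (vertex 1)) - int (\<sigma> (vertex 0)))"
    by (simp add: cong_iff_dvd_diff)
  then obtain k where "L (vertex 1) - L (vertex 0) - (int (\<sigma> (vertex 1)) - int (\<sigma> (vertex 0))) = int n * k" ..
  then have k: "L (vertex 1) - L (vertex 0) = int (\<sigma> (vertex 1)) - int (\<sigma> (vertex 0)) + int n * k"
    by simp
  have "winding n m \<sigma> = k"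
    unfolding winding_def
  proof (rule the_equality)
    show "\<exists>L. is_lift n m (standard_simplex 1) (\<lambda>x. int (\<sigma> x)) L \<and>
        L (vertex 1) - L (vertex 0) = int (\<sigma> (vertex 1)) - int (\<sigma> (vertex 0)) + int n * k"
      using L k by blast
    fix k'
    assume "\<exists>L. is_lift n m (standard_simplex 1) (\<lambda>x. int (\<sigma> x)) L \<and>
        L (vertex 1) - L (vertex 0) = int (\<sigma> (vertex 1)) - int (\<sigma> (vertex 0)) + int n * k'"
    then obtain L' where L': "is_lift n m (standard_simplex 1) (\<lambda>x. int (\<sigma> x)) L'"
      and k': "L' (vertex 1) - L' (vertex 0) = int (\<sigma> (vertex 1)) - int (\<sigma> (vertex 0)) + int n * k'"
      by blast
    obtain j where j: "\<And>x. x \<in> standard_simplex 1 \<Longrightarrow> L x = L' x + int n * j"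
      by (rule lifts_differ_by_constant [OF m connected_standard_simplex L L']) blast
    have "int n * k = int n * k'"
      using j [of "vertex 0"] j [of "vertex 1"] k k' by simp
    then show "k' = k" using m by simp
  qed
  with k show ?thesis by simp
qed

text \<open>Additive extension to chains. Integers are represented as multiples of the generator of the free
  Abelian group on one element, so that the additivity of \<open>frag_extend\<close> applies.\<close>
definition total_winding :: "nat \<Rightarrow> nat \<Rightarrow> nat chain \<Rightarrow> int"
  where "total_winding n m z =
    poly_mapping.lookup (frag_extend (\<lambda>\<sigma>. frag_cmul (winding n m \<sigma>) (frag_of ())) z) ()"

lemma total_winding_of [simp]: "total_winding n m (frag_of \<sigma>) = winding n m \<sigma>"
  by (simp add: total_winding_def)

lemma total_winding_0 [simp]: "total_winding n m 0 = 0"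
  by (simp add: total_winding_def)

lemma total_winding_add: "total_winding n m (a + b) = total_winding n m a + total_winding n m b"
  by (simp add: total_winding_def frag_extend_add lookup_add)

lemma total_winding_diff: "total_winding n m (a - b) = total_winding n m a - total_winding n m b"
  by (simp add: total_winding_def frag_extend_diff lookup_minus)

lemma total_winding_cmul: "total_winding n m (frag_cmul k a) = k * total_winding n m a"
  by (simp add: total_winding_def frag_extend_cmul)

abbreviation point_simplex :: "'a \<Rightarrow> (nat \<Rightarrow> real) \<Rightarrow> 'a"
  where "point_simplex a \<equiv> restrict (\<lambda>_. a) (standard_simplex 0)"

text \<open>A \<open>0\<close>-simplex is determined by its value at the only vertex.\<close>
lemma chain_boundary_1_of:
  "chain_boundary 1 (frag_of \<sigma>) =
     frag_of (point_simplex (\<sigma> (vertex 1))) - frag_of (point_simplex (\<sigma> (vertex 0)))"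
proof -
  have "standard_simplex 0 = {vertex 0}"
    by (simp add: standard_simplex_0 vertex_def)
  then have "singular_face (Suc 0) k \<sigma> = point_simplex (\<sigma> (simplical_face k (vertex 0)))" for k
    by (auto simp: singular_face_def)
  then show ?thesis
    by (simp add: chain_boundary_def simplical_face_vertex)
qed

lemma chain_boundary_2_of:
  "chain_boundary 2 (frag_of \<tau>) =
     frag_of (singular_face 2 0 \<tau>) - frag_of (singular_face 2 1 \<tau>) + frag_of (singular_face 2 2 \<tau>)"
  by (simp add: chain_boundary_def numeral_2_eq_2)

lemma singular_face_2_vertex:
  "i \<le> 1 \<Longrightarrow> singular_face 2 k \<tau> (vertex i) = \<tau> (vertex (if i < k then i else Suc i))"
  by (simp add: singular_face_def simplical_face_vertex)

lemma chain_boundary_boundary_2: "chain_boundary 1 (chain_boundary 2 c) = 0"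
proof (induction c rule: frag_induction [OF subset_UNIV])
  case (2 \<tau>)
  show ?case
    unfolding chain_boundary_2_of chain_boundary_add chain_boundary_diff chain_boundary_1_of
    by (simp add: singular_face_2_vertex numeral_2_eq_2 [symmetric])
qed (simp_all add: chain_boundary_diff)

text \<open>A lift of the triangle restricts to lifts of its three faces, and the increments of these along
  the boundary cancel, as do the differences of the values of \<open>\<tau>\<close>.\<close>
lemma total_winding_boundary:
  assumes m: "3 * m < n" and c: "Poly_Mapping.keys c \<subseteq> cyc_simplices n m 2"
  shows "total_winding n m (chain_boundary 2 c) = 0"
  using c
proof (induction c rule: frag_induction)
  case (one \<tau>)
  obtain L where L: "is_lift n m (standard_simplex 2) (\<lambda>x. int (\<tau> x)) L"
    using simplex_2_lift [OF m one] .
  have m2: "2 * m < n" using m by simp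
  define v where "v k i = vertex (if i < k then i else Suc i)" for k i :: nat
  have inc: "L (v k 1) - L (v k 0) =
      int (\<tau> (v k 1)) - int (\<tau> (v k 0)) + int n * winding n m (singular_face 2 k \<tau>)"
    if "k \<le> 2" for k
  proof -
    have "is_lift n m (standard_simplex 1) (\<lambda>x. int (\<tau> (simplical_face k x))) (\<lambda>x. L (simplical_face k x))"
      using simplical_face_in_standard_simplex [of 2 k] that
      by (intro is_lift_compose [OF L] continuous_on_simplical_face) auto
    then have "is_lift n m (standard_simplex 1) (\<lambda>x. int (singular_face 2 k \<tau> x)) (\<lambda>x. L (simplical_face k x))"
      by (simp add: is_lift_def singular_face_def)
    from lift_increment [OF m2 this] show ?thesis
      by (simp add: singular_face_2_vertex simplical_face_vertex v_def)
  qed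
  have "int n * (winding n m (singular_face 2 0 \<tau>) - winding n m (singular_face 2 1 \<tau>)
      + winding n m (singular_face 2 2 \<tau>)) = 0"
    using inc [of 0] inc [of 1] inc [of 2] by (simp add: v_def algebra_simps numeral_2_eq_2)
  then show ?case
    using m by (simp add: chain_boundary_2_of total_winding_add total_winding_diff)
qed (simp_all add: chain_boundary_diff total_winding_diff)

section \<open>Cones over paths of integers\<close>
text \<open>For \<open>r \<ge> 0\<close>, truncation to the interval from \<open>-r\<close> to \<open>r\<close>. It is used with a radius \<open>r\<close> that shrinks to \<open>0\<close>
  in steps of one, and so contracts bounded sets of integers.\<close>
definition cutoff :: "int \<Rightarrow> int \<Rightarrow> int"
  where "cutoff r a = max (- r) (min a r)"

text \<open>Truncation does not increase the larger of the distances between the radii and between the values.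
  For \<open>m \<ge> 1\<close> the radius may therefore jump by one while the value moves by \<open>m\<close>.\<close>
lemma near_cutoff:
  assumes "near m a b" "\<bar>r - s\<bar> \<le> int m"
  shows "near m (cutoff r a) (cutoff s b)"
  using assms unfolding near_def cutoff_def by linarith

lemma near_floor:
  fixes x y :: real
  assumes "\<bar>x - y\<bar> < 1"
  shows "\<bar>\<lfloor>x\<rfloor> - \<lfloor>y\<rfloor>\<bar> \<le> 1"
  using assms by linarith

definition project_simplex :: "nat \<Rightarrow> nat \<Rightarrow> ((nat \<Rightarrow> real) \<Rightarrow> int) \<Rightarrow> (nat \<Rightarrow> real) \<Rightarrow> nat"
  where "project_simplex p n L = restrict (\<lambda>x. nat (L x mod int n)) (standard_simplex p)"

lemma int_project_simplex:
  "0 < n \<Longrightarrow> x \<in> standard_simplex p \<Longrightarrow> int (project_simplex p n L x) = L x mod int n"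
  by (simp add: project_simplex_def)

lemma project_simplex_cong:
  "(\<And>x. x \<in> standard_simplex p \<Longrightarrow> [L x = M x] (mod int n)) \<Longrightarrow>
    project_simplex p n L = project_simplex p n M"
  by (auto simp: project_simplex_def cong_def restrict_def)

lemma cyc_near_mod: "near m a b \<Longrightarrow> cyc_near n m (a mod int n) (b mod int n)"
  unfolding near_def cyc_near_def
  by (intro exI [of _ "b - a"]) (simp add: cong_def mod_diff_eq)

lemma project_simplex_in_cyc_simplices:
  assumes n: "0 < n" and L: "locally_related (near m) (standard_simplex p) L"
  shows "project_simplex p n L \<in> cyc_simplices n m p"
proof -
  have "locally_related (cyc_near n m) (standard_simplex p) (\<lambda>x. int (project_simplex p n L x))"
    using L by (rule locally_related_map) (simp add: int_project_simplex n cyc_near_mod)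
  moreover have "project_simplex p n L x < n" if "x \<in> standard_simplex p" for x
    using int_project_simplex [OF n that, of L] n by (metis of_nat_0_less_iff of_nat_less_iff pos_mod_bound)
  ultimately show ?thesis
    by (auto simp: cyc_simplices_iff project_simplex_def)
qed

lemma is_lift_project_simplex:
  assumes n: "0 < n" and L: "locally_related (near m) (standard_simplex p) L"
  shows "is_lift n m (standard_simplex p) (\<lambda>x. int (project_simplex p n L x)) L"
  using L by (simp add: is_lift_def int_project_simplex n cong_def)

lemma singular_face_project_simplex:
  assumes "k \<le> 2"
  shows "singular_face 2 k (project_simplex 2 n L) = project_simplex 1 n (\<lambda>x. L (simplical_face k x))"
  using assms simplical_face_in_standard_simplex [of 2 k]
  by (auto simp: singular_face_def project_simplex_def restrict_def)

text \<open>For \<open>\<bar>a\<bar> \<le> N\<close>, the path from \<open>0\<close> to \<open>a\<close> that steps through the integers in between and then stays at \<open>a\<close>. The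
  same \<open>N\<close> will be used for all paths of a chain, as only rays with equal \<open>N\<close> occur as faces of one
  cone.\<close>
definition ray :: "nat \<Rightarrow> int \<Rightarrow> (nat \<Rightarrow> real) \<Rightarrow> int"
  where "ray N a x = cutoff \<lfloor>real N * x 1\<rfloor> a"

text \<open>The central projection of the triangle from its vertex \<open>0\<close> to the opposite edge, which is
  identified with the standard \<open>1\<close>-simplex. At the vertex itself the quotients are \<open>0\<close> and the value is
  not a point of that edge.\<close>
definition edge_point :: "(nat \<Rightarrow> real) \<Rightarrow> nat \<Rightarrow> real"
  where "edge_point x = (\<lambda>i. if i = 0 then x 1 / (x 1 + x 2) else if i = 1 then x 2 / (x 1 + x 2) else 0)"

text \<open>The cone over a path \<open>L\<close> with apex \<open>0\<close>: the value of \<open>L\<close> at the projection to the edge is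
  truncated with a radius that grows linearly with the distance from the apex. At the apex the
  radius is \<open>0\<close>, which hides the arbitrary value of the projection.\<close>
definition cone :: "nat \<Rightarrow> ((nat \<Rightarrow> real) \<Rightarrow> int) \<Rightarrow> (nat \<Rightarrow> real) \<Rightarrow> int"
  where "cone N L x = cutoff \<lfloor>real N * (x 1 + x 2)\<rfloor> (L (edge_point x))"

lemma open_coordinate_slab:
  fixes f :: "(nat \<Rightarrow> real) \<Rightarrow> real"
  assumes "continuous_on UNIV f"
  shows "open {y. \<bar>real N * f y - c\<bar> < 1}"
  using assms by (intro open_Collect_less continuous_intros)

lemma locally_related_ray:
  assumes "1 \<le> m"
  shows "locally_related (near m) S (ray N a)"
proof (rule locally_relatedI)
  fix x assume "x \<in> S"
  let ?U = "{y::nat \<Rightarrow> real. \<bar>real N * y 1 - real N * x 1\<bar> < 1}"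
  have "near m (ray N a x) (ray N a y)" if "y \<in> ?U" for y
    unfolding ray_def
  proof (rule near_cutoff)
    show "\<bar>\<lfloor>real N * x 1\<rfloor> - \<lfloor>real N * y 1\<rfloor>\<bar> \<le> int m"
      using near_floor [of "real N * x 1" "real N * y 1"] that assms by (simp add: abs_minus_commute)
  qed (simp add: near_def)
  moreover have "open ?U"
    by (intro open_coordinate_slab continuous_on_product_coordinates)
  ultimately show "\<exists>U. open U \<and> x \<in> U \<and> (\<forall>y\<in>U \<inter> S. near m (ray N a x) (ray N a y))"
    by (intro exI [of _ ?U]) simp
qed

lemma cutoff_0 [simp]: "cutoff 0 a = 0"
  by (simp add: cutoff_def)

lemma cutoff_eq_self: "\<bar>a\<bar> \<le> r \<Longrightarrow> cutoff r a = a"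
  by (simp add: cutoff_def)

lemma ray_vertex:
  "ray N a (vertex 0) = 0" "\<bar>a\<bar> \<le> int N \<Longrightarrow> ray N a (vertex 1) = a"
  by (simp_all add: ray_def vertex_def cutoff_eq_self)

text \<open>Near the apex the cone vanishes; elsewhere the projection is continuous, and \<open>L\<close> and the radius
  change by at most \<open>m\<close> and \<open>1\<close>.\<close>
lemma locally_related_cone:
  assumes m: "1 \<le> m" and L: "locally_related (near m) (standard_simplex 1) L"
  shows "locally_related (near m) (standard_simplex 2) (cone N L)"
proof (rule locally_relatedI)
  fix x :: "nat \<Rightarrow> real" assume x: "x \<in> standard_simplex 2"
  have co: "continuous_on S (\<lambda>y. y i)" for S :: "(nat \<Rightarrow> real) set" and i
    by (rule continuous_on_subset [OF continuous_on_product_coordinates subset_UNIV])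
  define V where "V = {y::nat \<Rightarrow> real. \<bar>real N * (y 1 + y 2) - real N * (x 1 + x 2)\<bar> < 1}"
  have V: "open V" "x \<in> V"
    unfolding V_def by (intro open_coordinate_slab continuous_intros co) simp
  show "\<exists>U. open U \<and> x \<in> U \<and> (\<forall>y\<in>U \<inter> standard_simplex 2. near m (cone N L x) (cone N L y))"
  proof (cases "x 1 + x 2 = 0")
    case True
    have "cone N L y = 0" if "y \<in> V" "y \<in> standard_simplex 2" for y
    proof -
      have "0 \<le> real N * (y 1 + y 2)" "real N * (y 1 + y 2) < 1"
        using that True by (auto simp: V_def simplex_2_iff)
      then have "\<lfloor>real N * (y 1 + y 2)\<rfloor> = 0" by linarith
      then show ?thesis by (simp add: cone_def)
    qed
    with V x show ?thesis by (intro exI [of _ V]) (simp add: near_def)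
  next
    case False
    define W where "W = {y::nat \<Rightarrow> real. 0 < y 1 + y 2}"
    have W: "open W" "x \<in> W"
      using False x unfolding W_def by (auto simp: simplex_2_iff intro!: open_Collect_less continuous_intros co)
    have "continuous_on (W \<inter> standard_simplex 2) edge_point"
    proof (rule continuous_on_coordinatewise_then_product)
      show "continuous_on (W \<inter> standard_simplex 2) (\<lambda>y. edge_point y i)" for i
        by (cases "i = 0"; cases "i = 1") (auto simp: edge_point_def W_def intro!: continuous_intros co)
    qed
    moreover have "edge_point ` (W \<inter> standard_simplex 2) \<subseteq> standard_simplex 1"
      by (auto simp: edge_point_def W_def simplex_1_iff simplex_2_iff add_divide_distrib [symmetric])
    ultimately have "locally_related (near m) (W \<inter> standard_simplex 2) (\<lambda>y. L (edge_point y))"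
      by (rule locally_related_compose [OF L])
    moreover have "x \<in> W \<inter> standard_simplex 2" using W x by simp
    ultimately obtain U where U: "open U" "x \<in> U"
      "\<And>y. y \<in> U \<Longrightarrow> y \<in> W \<inter> standard_simplex 2 \<Longrightarrow> near m (L (edge_point x)) (L (edge_point y))"
      by (rule locally_relatedE) blast
    have "near m (cone N L x) (cone N L y)" if y: "y \<in> U \<inter> V \<inter> W \<inter> standard_simplex 2" for y
    proof -
      have "near m (cutoff \<lfloor>real N * (x 1 + x 2)\<rfloor> (L (edge_point x))) (cutoff \<lfloor>real N * (y 1 + y 2)\<rfloor> (L (edge_point y)))"
      proof (rule near_cutoff)
        show "near m (L (edge_point x)) (L (edge_point y))" using U(3) y by simp
        show "\<bar>\<lfloor>real N * (x 1 + x 2)\<rfloor> - \<lfloor>real N * (y 1 + y 2)\<rfloor>\<bar> \<le> int m"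
          using near_floor [of "real N * (x 1 + x 2)" "real N * (y 1 + y 2)"] y m
          by (simp add: V_def abs_minus_commute)
      qed
      then show ?thesis by (simp add: cone_def)
    qed
    with U V W show ?thesis
      by (intro exI [of _ "U \<inter> V \<inter> W"]) (simp add: open_Int)
  qed
qed

lemma simplical_face_2_coordinates:
  "simplical_face 0 x (Suc 0) = x 0" "simplical_face 0 x 2 = x (Suc 0)"
  "simplical_face (Suc 0) x (Suc 0) = 0" "simplical_face (Suc 0) x 2 = x (Suc 0)"
  "simplical_face 2 x (Suc 0) = x (Suc 0)" "simplical_face 2 x 2 = 0"
  by (simp_all add: simplical_face_def)

lemma edge_point_faces:
  assumes x: "x \<in> standard_simplex 1"
  shows "edge_point (simplical_face 0 x) = x"
    and "x 1 \<noteq> 0 \<Longrightarrow> edge_point (simplical_face 1 x) = vertex 1"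
    and "x 1 \<noteq> 0 \<Longrightarrow> edge_point (simplical_face 2 x) = vertex 0"
  using x by (auto simp: edge_point_def simplical_face_2_coordinates simplex_1_iff vertex_def fun_eq_iff)

text \<open>For \<open>N\<close> beyond the range of \<open>L\<close>, the edge opposite to the apex carries \<open>L\<close> itself. On the edges
  through the apex the projection is constant, which leaves the rays to the end values of \<open>L\<close>.\<close>
lemma cone_faces:
  assumes x: "x \<in> standard_simplex 1"
  shows "\<bar>L x\<bar> \<le> int N \<Longrightarrow> cone N L (simplical_face 0 x) = L x"
    and "cone N L (simplical_face 1 x) = ray N (L (vertex 1)) x"
    and "cone N L (simplical_face 2 x) = ray N (L (vertex 0)) x"
proof -
  show "cone N L (simplical_face 0 x) = L x" if "\<bar>L x\<bar> \<le> int N"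
    using x edge_point_faces(1) [OF x] that
    by (simp add: cone_def simplical_face_2_coordinates simplex_1_iff cutoff_eq_self)
  show "cone N L (simplical_face 1 x) = ray N (L (vertex 1)) x"
    "cone N L (simplical_face 2 x) = ray N (L (vertex 0)) x"
    using edge_point_faces(2,3) [OF x]
    by (cases "x 1 = 0"; simp add: cone_def ray_def simplical_face_2_coordinates)+
qed

section \<open>Reduction of chains to rays\<close>
abbreviation cyc_boundaries :: "nat \<Rightarrow> nat \<Rightarrow> nat chain set"
  where "cyc_boundaries n m \<equiv> closure_boundaries (Suc 0) {..<n} (cyc_closure n m)"

lemma cyc_boundaries_iff:
  "b \<in> cyc_boundaries n m \<longleftrightarrow>
     (\<exists>c. Poly_Mapping.keys c \<subseteq> cyc_simplices n m 2 \<and> b = chain_boundary 2 c)"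
  by (simp add: closure_boundaries_def closure_chain_group_def numeral_2_eq_2 image_iff Bex_def)

lemma cyc_boundaries_0: "0 \<in> cyc_boundaries n m"
  unfolding cyc_boundaries_iff by (intro exI [of _ 0]) simp

lemma cyc_boundaries_diff:
  assumes "a \<in> cyc_boundaries n m" "b \<in> cyc_boundaries n m"
  shows "a - b \<in> cyc_boundaries n m"
proof -
  from assms obtain c d where "Poly_Mapping.keys c \<subseteq> cyc_simplices n m 2" "a = chain_boundary 2 c"
    "Poly_Mapping.keys d \<subseteq> cyc_simplices n m 2" "b = chain_boundary 2 d"
    unfolding cyc_boundaries_iff by blast
  then show ?thesis
    unfolding cyc_boundaries_iff using keys_diff [of c d]
    by (intro exI [of _ "c - d"]) (auto simp: chain_boundary_diff)
qed

lemma cyc_boundaries_add: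
  assumes "a \<in> cyc_boundaries n m" "b \<in> cyc_boundaries n m"
  shows "a + b \<in> cyc_boundaries n m"
  using cyc_boundaries_diff [OF assms(1) cyc_boundaries_diff [OF cyc_boundaries_0 assms(2)]] by simp

definition ray_chain :: "nat \<Rightarrow> nat \<Rightarrow> int \<Rightarrow> nat chain"
  where "ray_chain n N a = frag_of (project_simplex 1 n (ray N a))"

text \<open>The boundary of the cone over \<open>L\<close>. Up to homology a lifted path depends on its two end values
  only.\<close>
lemma path_homologous_to_rays:
  assumes n: "0 < n" and m: "1 \<le> m" and L: "locally_related (near m) (standard_simplex 1) L"
    and N: "\<And>x. x \<in> standard_simplex 1 \<Longrightarrow> \<bar>L x\<bar> \<le> int N"
  shows "frag_of (project_simplex 1 n L) - (ray_chain n N (L (vertex 1)) - ray_chain n N (L (vertex 0)))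
    \<in> cyc_boundaries n m"
proof -
  let ?\<tau> = "project_simplex 2 n (cone N L)"
  have "singular_face 2 0 ?\<tau> = project_simplex 1 n L"
    "singular_face 2 1 ?\<tau> = project_simplex 1 n (ray N (L (vertex 1)))"
    "singular_face 2 2 ?\<tau> = project_simplex 1 n (ray N (L (vertex 0)))"
    by (auto simp: singular_face_project_simplex cone_faces N intro!: project_simplex_cong simp del: One_nat_def)
  then have "chain_boundary 2 (frag_of ?\<tau>) = frag_of (project_simplex 1 n L)
      - (ray_chain n N (L (vertex 1)) - ray_chain n N (L (vertex 0)))"
    by (simp add: chain_boundary_2_of ray_chain_def)
  moreover have "?\<tau> \<in> cyc_simplices n m 2"
    by (intro project_simplex_in_cyc_simplices n locally_related_cone m L)
  ultimately show ?thesis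
    unfolding cyc_boundaries_iff by (intro exI [of _ "frag_of ?\<tau>"]) auto
qed

text \<open>The translate by \<open>n\<close> of the ray to \<open>a\<close> projects to the same simplex as the ray itself, but as a
  path from \<open>n\<close> to \<open>a + n\<close> it is homologous to the difference of two rays.\<close>
lemma ray_chain_shift:
  assumes n: "0 < n" and m: "1 \<le> m" and N: "int n \<le> int N" "\<bar>a\<bar> \<le> int N" "\<bar>a + int n\<bar> \<le> int N"
  shows "ray_chain n N a - (ray_chain n N (a + int n) - ray_chain n N (int n)) \<in> cyc_boundaries n m"
proof -
  let ?L = "\<lambda>x. ray N a x + int n"
  have "locally_related (near m) (standard_simplex 1) ?L"
    by (rule locally_related_map [OF locally_related_ray [OF m]]) (simp add: near_def)
  moreover have "\<bar>?L x\<bar> \<le> int N" if x: "x \<in> standard_simplex 1" for x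
  proof -
    have "0 \<le> real N * x 1" using x by (simp add: simplex_1_iff)
    then have "0 \<le> \<lfloor>real N * x 1\<rfloor>" by simp
    with N show ?thesis unfolding ray_def cutoff_def by linarith
  qed
  ultimately have "frag_of (project_simplex 1 n ?L) - (ray_chain n N (?L (vertex 1)) - ray_chain n N (?L (vertex 0)))
      \<in> cyc_boundaries n m"
    by (rule path_homologous_to_rays [OF n m])
  moreover have "project_simplex 1 n ?L = project_simplex 1 n (ray N a)"
    by (rule project_simplex_cong) (simp add: cong_def)
  ultimately show ?thesis
    using N by (simp add: ray_chain_def ray_vertex del: One_nat_def)
qed

text \<open>Going once more around the cycle adds one copy of the ray to \<open>n\<close>, which is a loop. All
  intermediate end points stay within the bound \<open>N\<close>, since \<open>a\<close> is reduced modulo \<open>n\<close> and \<open>n \<le> N\<close>.\<close>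
lemma ray_chain_periods:
  assumes n: "0 < n" and m: "1 \<le> m" and N: "n \<le> N" and a: "0 \<le> a" "a < int n"
    and k: "\<bar>a + int n * k\<bar> \<le> int N"
  shows "ray_chain n N (a + int n * k) - (ray_chain n N a + frag_cmul k (ray_chain n N (int n)))
    \<in> cyc_boundaries n m"
  using k
proof (induction k rule: int_induct [of _ 0])
  case base
  show ?case by (simp add: cyc_boundaries_0)
next
  case (step1 k)
  let ?b = "a + int n * k"
  have b: "?b + int n = a + int n * (k + 1)" by (simp add: algebra_simps)
  have "0 \<le> int n * k" using step1(1) by simp
  then have le: "\<bar>?b\<bar> \<le> int N" using step1(3) a unfolding b [symmetric] by linarith
  have "ray_chain n N ?b - (ray_chain n N (?b + int n) - ray_chain n N (int n)) \<in> cyc_boundaries n m"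
    using N le step1(3) by (intro ray_chain_shift n m) (simp_all add: b)
  from cyc_boundaries_diff [OF step1(2) [OF le] this] show ?case
    unfolding b by (simp add: frag_cmul_distrib algebra_simps)
next
  case (step2 k)
  let ?b = "a + int n * (k - 1)"
  have b: "?b + int n = a + int n * k" by (simp add: algebra_simps)
  have "int n * k \<le> 0" using step2(1) by (simp add: mult_nonneg_nonpos)
  moreover have "int n * (k - 1) = int n * k - int n" by (simp add: algebra_simps)
  ultimately have le: "\<bar>?b + int n\<bar> \<le> int N" using step2(3) a N by linarith
  have "ray_chain n N ?b - (ray_chain n N (?b + int n) - ray_chain n N (int n)) \<in> cyc_boundaries n m"
    using N le step2(3) by (intro ray_chain_shift n m) simp_all
  from cyc_boundaries_add [OF step2(2) [OF le [unfolded b]] this [unfolded b]] show ?case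
    by (simp add: frag_cmul_diff_distrib algebra_simps)
qed

text \<open>Finitely many neighbourhoods on which \<open>L\<close> moves by at most \<open>m\<close> cover \<open>S\<close>.\<close>
lemma locally_related_near_bounded:
  assumes S: "compact S" and L: "locally_related (near m) S L"
  obtains M where "\<And>x. x \<in> S \<Longrightarrow> \<bar>L x\<bar> \<le> int M"
proof -
  have "\<forall>x\<in>S. \<exists>U. open U \<and> x \<in> U \<and> (\<forall>y\<in>U \<inter> S. near m (L x) (L y))"
    using L by (simp add: locally_related_def)
  from bchoice [OF this] obtain U where
    U: "\<And>x. x \<in> S \<Longrightarrow> open (U x) \<and> x \<in> U x \<and> (\<forall>y\<in>U x \<inter> S. near m (L x) (L y))" by blast
  have "S \<subseteq> \<Union>(U ` S)" using U by blast
  then obtain D where D: "D \<subseteq> S" "finite D" "S \<subseteq> \<Union>(U ` D)"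
    using U by (blast intro: compactE_image [OF S, of S U])
  have "\<bar>L y\<bar> \<le> int (nat (\<Sum>x\<in>D. \<bar>L x\<bar>) + m)" if y: "y \<in> S" for y
  proof -
    obtain x where x: "x \<in> D" "y \<in> U x" using D(3) y by blast
    then have "near m (L x) (L y)" using U D(1) y by blast
    moreover have "\<bar>L x\<bar> \<le> (\<Sum>x\<in>D. \<bar>L x\<bar>)"
      using D(2) x(1) by (intro member_le_sum) auto
    ultimately show ?thesis unfolding near_def by linarith
  qed
  with that show thesis .
qed

lemma compact_standard_simplex: "compact (standard_simplex p)"
  using compactin_standard_simplex [of p] by (simp add: euclidean_product_topology)

text \<open>A \<open>1\<close>-simplex is expressed by the rays to its end values, which lie in \<open>{0..<n}\<close>, and the loop
  \<open>ray_chain n N n\<close>, with the winding number as coefficient. The lift is normalised to start at the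
  value of \<open>\<sigma>\<close>; then it ends at the end value of \<open>\<sigma>\<close> plus \<open>n\<close> times the winding number.\<close>
lemma cyc_simplex_homologous:
  assumes m: "1 \<le> m" "3 * m < n" and \<sigma>: "\<sigma> \<in> cyc_simplices n m 1"
  obtains N0 where "\<And>N. N0 \<le> N \<Longrightarrow> frag_of \<sigma> -
      (ray_chain n N (int (\<sigma> (vertex 1))) - ray_chain n N (int (\<sigma> (vertex 0)))
        + frag_cmul (winding n m \<sigma>) (ray_chain n N (int n))) \<in> cyc_boundaries n m"
proof -
  have n: "0 < n" and m2: "2 * m < n" using m by auto
  obtain L' where L': "is_lift n m (standard_simplex 1) (\<lambda>x. int (\<sigma> x)) L'"
    using simplex_1_lift [OF m(2) \<sigma>] .
  then have "[L' (vertex 0) = int (\<sigma> (vertex 0))] (mod int n)"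
    by (simp add: is_lift_def)
  then obtain j where j: "int (\<sigma> (vertex 0)) = L' (vertex 0) + int n * j"
    by (auto simp: cong_iff_lin mult.commute)
  define L where "L = (\<lambda>x. L' x + int n * j)"
  have L: "is_lift n m (standard_simplex 1) (\<lambda>x. int (\<sigma> x)) L"
    unfolding L_def using L' by (rule is_lift_shift)
  then have LL: "locally_related (near m) (standard_simplex 1) L"
    by (simp add: is_lift_def)
  have L0: "L (vertex 0) = int (\<sigma> (vertex 0))" by (simp add: L_def j)
  with lift_increment [OF m2 L] have L1: "L (vertex 1) = int (\<sigma> (vertex 1)) + int n * winding n m \<sigma>"
    by simp
  obtain M where M: "\<And>x. x \<in> standard_simplex 1 \<Longrightarrow> \<bar>L x\<bar> \<le> int M"
    by (rule locally_related_near_bounded [OF compact_standard_simplex LL]) blast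
  have \<sigma>L: "\<sigma> = project_simplex 1 n L"
  proof (rule extensionalityI [of _ "standard_simplex 1"])
    show "\<sigma> \<in> extensional (standard_simplex 1)" using \<sigma> by (simp add: cyc_simplices_iff)
    show "project_simplex 1 n L \<in> extensional (standard_simplex 1)" by (simp add: project_simplex_def)
    fix x assume x: "x \<in> standard_simplex 1"
    then have "L x mod int n = int (\<sigma> x)"
      using L cyc_simplex_lt [OF \<sigma> x] by (simp add: is_lift_def cong_def)
    with x show "\<sigma> x = project_simplex 1 n L x"
      by (simp add: project_simplex_def)
  qed
  have "frag_of \<sigma> - (ray_chain n N (int (\<sigma> (vertex 1))) - ray_chain n N (int (\<sigma> (vertex 0)))
        + frag_cmul (winding n m \<sigma>) (ray_chain n N (int n))) \<in> cyc_boundaries n m"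
    if N: "max n M \<le> N" for N
  proof -
    have MN: "\<bar>L x\<bar> \<le> int N" if "x \<in> standard_simplex 1" for x
      using M [OF that] N by linarith
    have 1: "frag_of \<sigma> - (ray_chain n N (L (vertex 1)) - ray_chain n N (L (vertex 0))) \<in> cyc_boundaries n m"
      using path_homologous_to_rays [OF n m(1) LL MN] \<sigma>L by simp
    have 2: "ray_chain n N (L (vertex 1)) - (ray_chain n N (int (\<sigma> (vertex 1)))
        + frag_cmul (winding n m \<sigma>) (ray_chain n N (int n))) \<in> cyc_boundaries n m"
      unfolding L1
    proof (rule ray_chain_periods [OF n m(1)])
      show "\<bar>int (\<sigma> (vertex 1)) + int n * winding n m \<sigma>\<bar> \<le> int N"
        using MN [of "vertex 1"] unfolding L1 by simp
    qed (use N cyc_simplex_lt [OF \<sigma>, of "vertex 1"] in simp_all)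
    from cyc_boundaries_add [OF 1 2] show ?thesis
      by (simp add: L0 algebra_simps)
  qed
  with that show thesis .
qed

text \<open>The rays to the end values add up to a linear function of the boundary, which vanishes on cycles.
  Since a chain has finitely many simplices, one \<open>N\<close> serves for all of them.\<close>
lemma cyc_chain_homologous:
  assumes m: "1 \<le> m" "3 * m < n" and z: "Poly_Mapping.keys z \<subseteq> cyc_simplices n m 1"
  shows "\<exists>N0. \<forall>N\<ge>N0. z - (frag_extend (\<lambda>s. ray_chain n N (int (s (vertex 0)))) (chain_boundary 1 z)
      + frag_cmul (total_winding n m z) (ray_chain n N (int n))) \<in> cyc_boundaries n m"
  using z
proof (induction z rule: frag_induction)
  case zero
  show ?case by (simp add: cyc_boundaries_0)
next
  case (one \<sigma>)
  then obtain N0 where "\<And>N. N0 \<le> N \<Longrightarrow> frag_of \<sigma> -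
      (ray_chain n N (int (\<sigma> (vertex 1))) - ray_chain n N (int (\<sigma> (vertex 0)))
        + frag_cmul (winding n m \<sigma>) (ray_chain n N (int n))) \<in> cyc_boundaries n m"
    using cyc_simplex_homologous [OF m] by blast
  then show ?case
    unfolding chain_boundary_1_of by (intro exI [of _ N0]) (simp add: frag_extend_diff)
next
  case (diff a b)
  let ?F = "\<lambda>N z. frag_extend (\<lambda>s. ray_chain n N (int (s (vertex 0)))) (chain_boundary 1 z)
      + frag_cmul (total_winding n m z) (ray_chain n N (int n))"
  from diff obtain Na Nb where
    Na: "\<And>N. Na \<le> N \<Longrightarrow> a - ?F N a \<in> cyc_boundaries n m" and
    Nb: "\<And>N. Nb \<le> N \<Longrightarrow> b - ?F N b \<in> cyc_boundaries n m"
    by blast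
  have "a - b - ?F N (a - b) \<in> cyc_boundaries n m" if "max Na Nb \<le> N" for N
  proof -
    have "?F N (a - b) = ?F N a - ?F N b"
      by (simp add: chain_boundary_diff frag_extend_diff total_winding_diff frag_cmul_diff_distrib)
    then have "a - b - ?F N (a - b) = (a - ?F N a) - (b - ?F N b)" by simp
    also have "\<dots> \<in> cyc_boundaries n m"
      using that by (intro cyc_boundaries_diff Na Nb) auto
    finally show ?thesis .
  qed
  then show ?case by blast
qed

section \<open>The winding number as an isomorphism\<close>
abbreviation cyc_cycles :: "nat \<Rightarrow> nat \<Rightarrow> nat chain set"
  where "cyc_cycles n m \<equiv> closure_cycles (Suc 0) {..<n} (cyc_closure n m)"

lemma cyc_cycles_iff:
  "z \<in> cyc_cycles n m \<longleftrightarrow>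
     Poly_Mapping.keys z \<subseteq> cyc_simplices n m 1 \<and> chain_boundary 1 z = 0"
  by (simp add: closure_cycles_def closure_chain_group_def)

lemma cyc_boundary_iff_total_winding_0:
  assumes m: "1 \<le> m" "3 * m < n"
  shows "b \<in> cyc_boundaries n m \<longleftrightarrow> b \<in> cyc_cycles n m \<and> total_winding n m b = 0"
proof
  assume "b \<in> cyc_boundaries n m"
  then obtain c where c: "Poly_Mapping.keys c \<subseteq> cyc_simplices n m 2" and b: "b = chain_boundary 2 c"
    unfolding cyc_boundaries_iff by blast
  have "Poly_Mapping.keys (chain_boundary 2 c) \<subseteq> cyc_simplices n m 1"
    using c
  proof (induction c rule: frag_induction)
    case (one \<tau>)
    then have face: "singular_face 2 k \<tau> \<in> cyc_simplices n m 1" if "k \<le> 2" for k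
      using singular_face_cyc_simplex [where p = 2 and k = k] that by (simp add: numeral_2_eq_2)
    show ?case
      unfolding chain_boundary_2_of using face [of 0] face [of 1] face [of 2]
      by (intro order_trans [OF keys_add] Un_least order_trans [OF keys_diff]) auto
  next
    case (diff a b)
    then show ?case
      using keys_diff [of "chain_boundary 2 a" "chain_boundary 2 b"] by (auto simp: chain_boundary_diff)
  qed simp
  then show "b \<in> cyc_cycles n m \<and> total_winding n m b = 0"
    using total_winding_boundary [OF m(2) c] chain_boundary_boundary_2 [of c]
    by (simp add: cyc_cycles_iff b)
next
  assume "b \<in> cyc_cycles n m \<and> total_winding n m b = 0"
  then have b: "Poly_Mapping.keys b \<subseteq> cyc_simplices n m 1" "chain_boundary 1 b = 0" "total_winding n m b = 0"
    by (simp_all add: cyc_cycles_iff)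
  from cyc_chain_homologous [OF m b(1)] show "b \<in> cyc_boundaries n m"
    unfolding b(2,3) by auto
qed

text \<open>The ray to \<open>n\<close> becomes a loop that runs once around the cycle.\<close>
lemma unit_winding_cycle:
  assumes m: "1 \<le> m" "3 * m < n"
  shows "ray_chain n n (int n) \<in> cyc_cycles n m" "total_winding n m (ray_chain n n (int n)) = 1"
proof -
  have n: "0 < n" and m2: "2 * m < n" using m by auto
  let ?L = "ray n (int n)" and ?\<sigma> = "project_simplex 1 n (ray n (int n))"
  have L: "locally_related (near m) (standard_simplex 1) ?L"
    by (rule locally_related_ray [OF m(1)])
  have "?\<sigma> (vertex i) = 0" if "i \<le> 1" for i
    using that ray_vertex [where N = n and a = "int n"] by (cases "i = 0") (simp_all add: project_simplex_def le_Suc_eq)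
  then have 0: "?\<sigma> (vertex 0) = 0" "?\<sigma> (vertex 1) = 0" by simp_all
  then have "chain_boundary 1 (frag_of ?\<sigma>) = 0"
    unfolding chain_boundary_1_of by simp
  then show "ray_chain n n (int n) \<in> cyc_cycles n m"
    using project_simplex_in_cyc_simplices [OF n L] by (simp add: cyc_cycles_iff ray_chain_def)
  have "int n = int n * winding n m ?\<sigma>"
    using lift_increment [OF m2 is_lift_project_simplex [OF n L]] 0 ray_vertex [where N = n and a = "int n"] by simp
  then show "total_winding n m (ray_chain n n (int n)) = 1"
    using n by (simp add: ray_chain_def)
qed

text \<open>On cycles the total winding number is a homomorphism onto the integers whose kernel consists of the
  boundaries.\<close>
lemma cyc_homology_iso_integers:
  assumes m: "1 \<le> m" "3 * m < n"
  shows "closure_homology_group 1 {..<n} (cyc_closure n m) \<cong> integer_group"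
proof -
  define C where "C = closure_chain_group 1 {..<n} (cyc_closure n m)"
  have C: "C = free_Abelian_group (cyc_simplices n m 1)"
    by (simp add: C_def closure_chain_group_def)
  have gC: "group C" by (simp add: C group_free_Abelian_group)
  have sub: "subgroup (cyc_cycles n m) C"
  proof (rule group.subgroupI [OF gC])
    show "cyc_cycles n m \<subseteq> carrier C" by (auto simp: cyc_cycles_iff C)
    have "0 \<in> cyc_cycles n m" by (simp add: cyc_cycles_iff)
    then show "cyc_cycles n m \<noteq> {}" by blast
    show "inv\<^bsub>C\<^esub> a \<in> cyc_cycles n m" if "a \<in> cyc_cycles n m" for a
      using that by (simp add: cyc_cycles_iff C chain_boundary_minus)
    show "a \<otimes>\<^bsub>C\<^esub> b \<in> cyc_cycles n m" if "a \<in> cyc_cycles n m" "b \<in> cyc_cycles n m" for a b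
      using that keys_add [of a b] by (auto simp: cyc_cycles_iff C chain_boundary_add)
  qed
  define G where "G = subgroup_generated C (cyc_cycles n m)"
  have carG: "carrier G = cyc_cycles n m"
    unfolding G_def using sub by (rule subgroup.carrier_subgroup_generated_subgroup)
  have gG: "group G" unfolding G_def by (rule group.group_subgroup_generated [OF gC])
  have hom: "total_winding n m \<in> hom G integer_group"
    by (auto simp: hom_def G_def C total_winding_add)
  interpret h: group_hom G integer_group "total_winding n m"
    by (intro group_hom.intro gG group_integer_group group_hom_axioms.intro hom)
  have "kernel G integer_group (total_winding n m) = cyc_boundaries n m"
    using cyc_boundary_iff_total_winding_0 [OF m] by (auto simp: kernel_def carG)
  moreover have "total_winding n m ` carrier G = carrier integer_group"
  proof -
    have "k \<in> total_winding n m ` cyc_cycles n m" for k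
    proof (rule image_eqI)
      let ?z = "frag_cmul k (ray_chain n n (int n))"
      show "k = total_winding n m ?z"
        using unit_winding_cycle(2) [OF m] by (simp add: total_winding_cmul)
      show "?z \<in> cyc_cycles n m"
        using unit_winding_cycle(1) [OF m] keys_cmul [of k "ray_chain n n (int n)"]
        by (auto simp: cyc_cycles_iff chain_boundary_cmul)
    qed
    then show ?thesis by (auto simp: carG)
  qed
  then have "G Mod kernel G integer_group (total_winding n m) \<cong> integer_group"
    by (rule h.FactGroup_iso)
  ultimately show ?thesis
    by (simp add: closure_homology_group_def G_def C_def)
qed

section \<open>Homology of the indiscrete cycle\<close>
lemma closure_homology_group_cong:
  assumes "\<And>A. A \<subseteq> X \<Longrightarrow> c A = d A"
  shows "closure_homology_group p X c = closure_homology_group p X d"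
proof -
  have "closure_continuous S e X c f = closure_continuous S e X d f"
    for S :: "(nat \<Rightarrow> real) set" and e f
  proof -
    have "c (f ` A) = d (f ` A)" if "f \<in> S \<rightarrow> X" "A \<subseteq> S" for A
      using that by (intro assms) auto
    then show ?thesis
      by (simp add: closure_continuous_def cong: conj_cong)
  qed
  then have "closure_singular_simplices q X c = closure_singular_simplices q X d" for q
    by (simp add: closure_singular_simplices_def)
  then show ?thesis
    by (simp add: closure_homology_group_def closure_cycles_def closure_boundaries_def
        closure_chain_group_def)
qed

text \<open>For \<open>n div 2 \<le> m\<close> any two points of the cycle are within distance \<open>m\<close>, and \<open>c\<^sub>m\<close> is the closure
  operator of this topology.\<close>
definition indiscrete_topology :: "'a set \<Rightarrow> 'a topology"
  where "indiscrete_topology X = topology (\<lambda>S. S = {} \<or> S = X)"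

lemma openin_indiscrete_topology: "openin (indiscrete_topology X) S \<longleftrightarrow> S = {} \<or> S = X"
proof -
  have "\<Union>\<K> = {} \<or> \<Union>\<K> = X" if "\<forall>K\<in>\<K>. K = {} \<or> K = X" for \<K>
    using that by blast
  then have "istopology (\<lambda>S. S = {} \<or> S = X)"
    by (auto simp: istopology_def)
  then show ?thesis by (simp add: indiscrete_topology_def topology_inverse')
qed

lemma topspace_indiscrete_topology [simp]: "topspace (indiscrete_topology X) = X"
  unfolding topspace_def openin_indiscrete_topology by auto

lemma continuous_map_indiscrete_topology:
  assumes "f \<in> topspace T \<rightarrow> X"
  shows "continuous_map T (indiscrete_topology X) f"
proof -
  have "{x \<in> topspace T. f x \<in> X} = topspace T" using assms by auto
  with assms show ?thesis
    by (auto simp: continuous_map_def openin_indiscrete_topology)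
qed

text \<open>Every map into the space is continuous, in particular the homotopy that jumps from the identity to
  a constant map immediately after time \<open>0\<close>.\<close>
lemma contractible_space_indiscrete_topology:
  assumes "a \<in> X"
  shows "contractible_space (indiscrete_topology X)"
  unfolding contractible_space_def homotopic_with_def
  using assms
  by (intro exI [of _ a] exI [of _ "\<lambda>(t, x). if t = 0 then x else a"] conjI continuous_map_indiscrete_topology)
    auto

lemma cyc_near_if_half:
  assumes "n div 2 \<le> m" "i < n" "j < n"
  shows "cyc_near n m (int i) (int j)"
proof -
  \<comment> \<open>Of the representatives \<open>d\<close>, \<open>d - n\<close> and \<open>d + n\<close> of the difference \<open>d\<close>, one is small.\<close>
  define k where "k = (if int j - int i > int m then int j - int i - int n
    else if int j - int i < - int m then int j - int i + int n else int j - int i)"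
  have "[k = int j - int i] (mod int n)"
    by (simp add: k_def cong_def)
  moreover have "\<bar>k\<bar> \<le> int m"
    using assms unfolding k_def by auto
  ultimately show ?thesis unfolding cyc_near_def by blast
qed

lemma cyc_homology_trivial:
  assumes n: "1 \<le> n" and m: "n div 2 \<le> m"
  shows "trivial_group (closure_homology_group 1 {..<n} (cyc_closure n m))"
proof -
  let ?T = "indiscrete_topology {..<n}"
  have "cyc_closure n m A = ?T closure_of A" if A: "A \<subseteq> {..<n}" for A
  proof (cases "A = {}")
    case True
    then show ?thesis by (simp add: cyc_closure_def)
  next
    case False
    then obtain i where "i \<in> A" by blast
    with A have "cyc_closure n m A = {..<n}"
      using cyc_near_if_half [OF m] by (auto simp: cyc_closure_def cyc_dist_le_iff)
    moreover have "?T closure_of A = {..<n}"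
      using \<open>i \<in> A\<close> A by (auto simp: closure_of_def openin_indiscrete_topology)
    ultimately show ?thesis by simp
  qed
  then have "closure_homology_group 1 {..<n} (cyc_closure n m) =
      closure_homology_group 1 (topspace ?T) ((closure_of) ?T)"
    unfolding topspace_indiscrete_topology by (rule closure_homology_group_cong)
  also have "\<dots> = reduced_homology_group 1 ?T"
    using closure_homology_group_topology [of 1 ?T] by (simp add: un_reduced_homology_group)
  finally show ?thesis
    using contractible_space_indiscrete_topology [of 0 "{..<n}"] n
    by (simp add: trivial_reduced_homology_group_contractible_space)
qed

section \<open>The first homology group\<close>
theorem corollary5p8:
  fixes n m :: nat
  assumes "n \<ge> 1"
  shows "(3 \<le> 3 * m \<and> 3 * m < n \<longrightarrow>
            closure_homology_group 1 {..<n} (cyc_closure n m) \<cong> integer_group) \<and>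
         (n div 2 \<le> m \<or> (n = 3 \<and> 1 \<le> m) \<longrightarrow>
            trivial_group (closure_homology_group 1 {..<n} (cyc_closure n m)))"
proof (intro conjI impI)
  assume "3 \<le> 3 * m \<and> 3 * m < n"
  then show "closure_homology_group 1 {..<n} (cyc_closure n m) \<cong> integer_group"
    by (intro cyc_homology_iso_integers) auto
next
  assume "n div 2 \<le> m \<or> (n = 3 \<and> 1 \<le> m)"
  then have "n div 2 \<le> m" by auto
  with assms show "trivial_group (closure_homology_group 1 {..<n} (cyc_closure n m))"
    by (rule cyc_homology_trivial)
qed

end
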